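(* Let $A$ be a real division algebra of degree $\leq 4$ with a (two-sided) unit element $e$, and let $p,q,r\in\{1,2\}$ be fixed. Then the following assertions are equivalent: (1) $A$ satisfies the identity $(x^p,x^q,x^r)=0$ for all $x\in A$. (2) $A$ is power-associative. (3) $A$ is quadratic.
   Context: An algebra over a field is a vector space with a bilinear product, not assumed associative, commutative or unital. The associator is $(x,y,z)=(xy)z-x(yz)$; $x^1=x$ and $x^2=xx$. A real division algebra is a (nonzero) finite-dimensional algebra $A$ over $\mathbb{R}$ such that for every $x\in A\setminus\{0\}$ the left and right multiplication operators $L_x:y\mapsto xy$ and $R_x:y\mapsto yx$ are bijective. For $x\in A$, $A(x)$ denotes the subalgebra of $A$ generated by $x$. The degree of a finite-dimensional algebra $A$ is $\max\{\dim A(y): y\in A\}$. An algebra $A$ is power-associative if $A(x)$ is associative for all $x\in A$. An algebra $A$ is quadratic if it contains a two-sided unit element $e$ and for every $x\in A$ the elements $e,x,x^2$ are linearly dependent. *)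

theory Defs
  imports "HOL-Analysis.Analysis"
begin

text \<open>
  A real algebra is a type of class \<open>real_vector\<close> together with a bilinear product
  \<open>m\<close>; the class fixes no norm, inner product or dimension.
\<close>

definition associator :: "('a::real_vector \<Rightarrow> 'a \<Rightarrow> 'a) \<Rightarrow> 'a \<Rightarrow> 'a \<Rightarrow> 'a \<Rightarrow> 'a" where
  "associator m x y z = m (m x y) z - m x (m y z)"

text \<open>
  Right-nested powers: \<open>alg_pow m x 1 = x\<close> and \<open>alg_pow m x 2 = m x x\<close>. The
  bracketing is a convention only from exponent 3 on. The value at exponent 0 is junk.
\<close>

definition alg_pow :: "('a \<Rightarrow> 'a \<Rightarrow> 'a) \<Rightarrow> 'a \<Rightarrow> nat \<Rightarrow> 'a" where
  "alg_pow m x n = (m x ^^ (n - 1)) x"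

definition two_sided_unit :: "('a \<Rightarrow> 'a \<Rightarrow> 'a) \<Rightarrow> 'a \<Rightarrow> bool" where
  "two_sided_unit m e \<longleftrightarrow> (\<forall>x. m e x = x \<and> m x e = x)"

definition real_division_algebra :: "('a::real_vector \<Rightarrow> 'a \<Rightarrow> 'a) \<Rightarrow> bool" where
  "real_division_algebra m \<longleftrightarrow>
     bilinear m \<and>
     (\<exists>B::'a set. finite B \<and> span B = UNIV) \<and>
     (\<exists>x::'a. x \<noteq> 0) \<and>
     (\<forall>x. x \<noteq> 0 \<longrightarrow> bij (\<lambda>y. m x y) \<and> bij (\<lambda>y. m y x))"

definition subalgebra :: "('a::real_vector \<Rightarrow> 'a \<Rightarrow> 'a) \<Rightarrow> 'a set \<Rightarrow> bool" where
  "subalgebra m S \<longleftrightarrow> subspace S \<and> (\<forall>x\<in>S. \<forall>y\<in>S. m x y \<in> S)"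

text \<open>
  Subalgebras need not contain a unit element, even if the whole algebra has one.
\<close>

definition generated_subalgebra :: "('a::real_vector \<Rightarrow> 'a \<Rightarrow> 'a) \<Rightarrow> 'a \<Rightarrow> 'a set" where
  "generated_subalgebra m x = subalgebra m hull {x}"

text \<open>
  For a finite-dimensional algebra the set of dimensions is finite and nonempty, so
  that \<open>Max\<close> is its maximum.
\<close>

definition alg_degree :: "('a::real_vector \<Rightarrow> 'a \<Rightarrow> 'a) \<Rightarrow> nat" where
  "alg_degree m = Max {dim (generated_subalgebra m y) | y. True}"

definition power_associative :: "('a::real_vector \<Rightarrow> 'a \<Rightarrow> 'a) \<Rightarrow> bool" where
  "power_associative m \<longleftrightarrow>
     (\<forall>x. \<forall>a\<in>generated_subalgebra m x. \<forall>b\<in>generated_subalgebra m x.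
        \<forall>c\<in>generated_subalgebra m x. m (m a b) c = m a (m b c))"

text \<open>
  Linear dependence is that of the family \<open>(e, x, x\<^sup>2)\<close>, with repetitions. The predicate
  \<open>dependent {e, x, m x x}\<close> on sets would be wrong: for \<open>x = e\<close> the set collapses to
  \<open>{e}\<close>.
\<close>

definition quadratic_algebra :: "('a::real_vector \<Rightarrow> 'a \<Rightarrow> 'a) \<Rightarrow> bool" where
  "quadratic_algebra m \<longleftrightarrow>
     (\<exists>e. two_sided_unit m e \<and>
        (\<forall>x. \<exists>a b c::real. (a, b, c) \<noteq> (0, 0, 0) \<and>
           a *\<^sub>R e + b *\<^sub>R x + c *\<^sub>R m x x = 0))"

end

theory Submission imports Defs begin

text \<open>
  Substituting \<open>x + t e\<close> for \<open>x\<close>, every identity \<open>(x\<^sup>p, x\<^sup>q, x\<^sup>r) = 0\<close> yields \<open>(x, x, x) = 0\<close>, which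
  says that \<open>x\<close> and \<open>x\<^sup>2\<close> commute. Suppose that \<open>e, x, x\<^sup>2\<close> are independent, so that \<open>A(x)\<close> has
  dimension 3 or 4. In dimension 3 it is visibly commutative; in dimension 4 the linearized
  identity also forces commutativity. But a commutative real division algebra has dimension at
  most 2 (Hopf): otherwise squaring would be a two-sheeted covering of the simply connected
  punctured space by itself, and a section of it would select one of \<open>x\<close>, \<open>-x\<close> continuously.
\<close>

section \<open>Hopf's theorem on commutative division algebras\<close>

text \<open>Commutativity gives the factorization a^2 - b^2 = (a - b)(a + b), and one of the factors
  must vanish.\<close>

lemma square_eq_iff_of_commutative:
  assumes f: "bilinear f" and comm: "\<And>x y. f x y = f y x"
    and nz: "\<And>x y. f x y = 0 \<Longrightarrow> x = 0 \<or> y = 0"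
  shows "f a a = f b b \<longleftrightarrow> a = b \<or> a = - b"
proof -
  have "f (a - b) (a + b) = f a a - f b b"
    using comm[of a b]
    by (simp add: bilinear_lsub[OF f] bilinear_radd[OF f] algebra_simps)
  then show ?thesis
    using nz[of "a - b" "a + b"]
    by (auto simp: bilinear_lzero[OF f] bilinear_lneg[OF f] bilinear_rneg[OF f] bilinear_rzero[OF f] eq_neg_iff_add_eq_0)
qed

text \<open>Over a Euclidean type, invariance of domain and covering space theory apply to the
  squaring map \<open>q\<close>, whose fibres are the pairs {x, -x}.\<close>

theorem hopf_commutative_division:
  fixes f :: "'b::euclidean_space \<Rightarrow> 'b \<Rightarrow> 'b"
  assumes f: "bilinear f" and comm: "\<And>x y. f x y = f y x"
    and nz: "\<And>x y. f x y = 0 \<Longrightarrow> x = 0 \<or> y = 0"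
  shows "DIM('b) \<le> 2"
proof (rule ccontr)
  assume "\<not> DIM('b) \<le> 2"
  then have dim: "3 \<le> DIM('b)" by simp
  interpret bounded_bilinear f
    using f bilinear_conv_bounded_bilinear by blast
  define q where "q x = f x x" for x
  have cont: "continuous_on S q" for S
    unfolding q_def by (intro continuous_on continuous_on_id)
  have q_eq: "q a = q b \<longleftrightarrow> a = b \<or> a = - b" for a b
    unfolding q_def by (rule square_eq_iff_of_commutative[OF f comm nz])
  have q0: "q x = 0 \<longleftrightarrow> x = 0" for x
    using nz[of x x] by (auto simp: q_def zero_left)
  have qneg: "q (- x) = q x" for x
    using q_eq by blast
  \<comment> \<open>A ball about x reaching just up to 0 cannot contain both y and -y: x - y and x +
    y sum to 2x, so they are not both shorter than \<open>norm x\<close>. These balls will be the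
    sheets of the covering.\<close>
  have ball: "inj_on q (ball x (norm x))" "ball x (norm x) \<inter> uminus ` ball x (norm x) = {}"
    "0 \<notin> ball x (norm x)" for x
  proof -
    have no: False if "y \<in> ball x (norm x)" "- y \<in> ball x (norm x)" for y
    proof -
      have "norm ((x - y) + (x - - y)) < norm x + norm x"
        using that by (intro norm_triangle_lt add_strict_mono) (auto simp: dist_norm)
      moreover have "(x - y) + (x - - y) = 2 *\<^sub>R x" by (simp add: scaleR_2)
      ultimately show False by simp
    qed
    then show "inj_on q (ball x (norm x))" "ball x (norm x) \<inter> uminus ` ball x (norm x) = {}"
      by (auto simp: inj_on_def q_eq simp del: mem_ball)
    show "0 \<notin> ball x (norm x)" by simp
  qed
  have qopen: "open (q ` ball x (norm x))" for x
    by (rule invariance_of_domain[OF cont _ ball(1)]) simp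
  let ?P = "- {0::'b}"
  have "?P = (\<Union>x\<in>?P. ball x (norm x))"
    using ball(3) by (auto simp del: mem_ball intro: centre_in_ball[THEN iffD2])
  from arg_cong[OF this, of "(`) q"] have qP: "q ` ?P = (\<Union>x\<in>?P. q ` ball x (norm x))"
    by (simp only: image_UN)
  \<comment> \<open>As \<open>q\<close> is homogeneous of degree 2, its range is the cone over the
    compact image of the unit sphere. That image avoids 0, so the cone is closed. Together with
    openness this makes the image of the punctured space clopen, hence everything.\<close>
  have "range q = conic hull (q ` sphere 0 1)"
  proof -
    have sc: "q (c *\<^sub>R x) = c\<^sup>2 *\<^sub>R q x" for c x
      by (simp add: q_def scaleR_left scaleR_right power2_eq_square)
    have "q x \<in> conic hull (q ` sphere 0 1)" for x
    proof (cases "x = 0")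
      case True
      obtain b :: 'b where "b \<in> Basis" using nonempty_Basis by blast
      then have "q x = 0 *\<^sub>R q b" "b \<in> sphere 0 1" using True q0 by auto
      then show ?thesis unfolding conic_hull_explicit by blast
    next
      case False
      then have "q x = (norm x)\<^sup>2 *\<^sub>R q (sgn x)" "sgn x \<in> sphere 0 1"
        using sc[of "norm x" "sgn x"] by (auto simp: sgn_div_norm)
      then show ?thesis unfolding conic_hull_explicit by fastforce
    qed
    moreover have "c *\<^sub>R q x \<in> range q" if "0 \<le> c" for c x
      using sc[of "sqrt c" x] that by (metis rangeI real_sqrt_pow2)
    ultimately show ?thesis unfolding conic_hull_explicit by blast
  qed
  moreover have "compact (q ` sphere 0 1)"
    by (intro compact_continuous_image cont) simp
  moreover have "0 \<notin> q ` sphere 0 1"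
  proof
    assume "0 \<in> q ` sphere 0 1"
    then obtain x where "norm x = 1" "q x = 0" by auto
    then show False using q0 by simp
  qed
  ultimately have "closed (range q)"
    using closed_conic_hull by metis
  then have "closedin (top_of_set ?P) (q ` ?P)"
    using q0 by (auto simp: closedin_closed intro!: exI[of _ "range q"])
  moreover have "openin (top_of_set ?P) (q ` ?P)"
  proof (rule open_subset)
    show "q ` ?P \<subseteq> ?P" by (intro image_subsetI) (simp add: q0)
    show "open (q ` ?P)" unfolding qP using qopen by blast
  qed
  moreover have "connected ?P"
    using dim by (intro connected_punctured_universe) simp
  ultimately have surj: "q ` ?P = ?P"
    using connected_clopen[of ?P] dim nonempty_Basis nonzero_Basis by fastforce
  have "covering_space ?P q ?P"
    unfolding covering_space_def
  proof (intro conjI ballI cont surj)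
    fix y assume "y \<in> ?P"
    then obtain x where x: "x \<noteq> 0" "y = q x" using surj by blast
    \<comment> \<open>The image of \<open>U\<close> is evenly covered: its preimage is the disjoint
      union of \<open>U\<close> and -\<open>U\<close>, and invariance of domain makes
      \<open>q\<close> a homeomorphism on each.\<close>
    define U where "U = ball x (norm x)"
    have U: "0 \<notin> U" "U \<inter> uminus ` U = {}" "open U" "open (q ` U)" "x \<in> U"
      unfolding U_def by (fact ball(3) ball(2) open_ball qopen)+ (simp add: x(1))
    have hom: "\<exists>r. homeomorphism V (q ` U) q r" if "V = U \<or> V = uminus ` U" for V
    proof -
      have img: "q ` V = q ` U" using that by (auto simp: image_image qneg)
      have "open V" using that by (auto simp: U_def open_negations)
      moreover have "inj_on q V"
        using that ball(1)[of x, folded U_def] by (elim disjE) (simp_all add: inj_on_def qneg)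
      ultimately obtain r where "homeomorphism V (q ` V) q r"
        by (rule invariance_of_domain_homeomorphism[OF _ cont order_refl])
      then show ?thesis using img by auto
    qed
    show "\<exists>T. y \<in> T \<and> openin (top_of_set ?P) T \<and>
      (\<exists>v. \<Union>v = ?P \<inter> q -` T \<and> (\<forall>u\<in>v. openin (top_of_set ?P) u) \<and>
         pairwise disjnt v \<and> (\<forall>u\<in>v. \<exists>r. homeomorphism u T q r))"
    proof (intro exI[of _ "q ` U"] conjI exI[of _ "{U, uminus ` U}"])
      show "y \<in> q ` U" using U(5) x(2) by blast
      show "openin (top_of_set ?P) (q ` U)"
      proof (rule open_subset)
        show "q ` U \<subseteq> ?P" using U(1) q0 by fastforce
      qed (fact U(4))
      show "\<Union>{U, uminus ` U} = ?P \<inter> q -` (q ` U)"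
      proof (intro equalityI subsetI)
        fix z assume "z \<in> ?P \<inter> q -` (q ` U)"
        then obtain u where "u \<in> U" "z = u \<or> z = - u" using q_eq by auto
        then show "z \<in> \<Union>{U, uminus ` U}" by auto
      qed (use U(1) qneg in auto)
      show "\<forall>u\<in>{U, uminus ` U}. openin (top_of_set ?P) u"
        using U(1) open_negations[OF U(3)] U(3) by (auto intro!: open_subset)
      show "pairwise disjnt {U, uminus ` U}"
        using U(2) by (auto simp: pairwise_def disjnt_def)
      show "\<forall>u\<in>{U, uminus ` U}. \<exists>r. homeomorphism u (q ` U) q r"
        using hom by blast
    qed
  qed
  \<comment> \<open>From dimension 3 on the punctured space is simply connected, so its identity map
    lifts through \<open>q\<close>; the lift is a continuous choice of square roots.\<close>
  then obtain g where g: "continuous_on ?P g" "g \<in> ?P \<rightarrow> ?P" "\<And>y. y \<in> ?P \<Longrightarrow> q (g y) = y"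
    using covering_space_lift[of ?P q ?P ?P id] simply_connected_punctured_universe[OF dim]
      open_imp_locally_path_connected[of ?P] by (auto simp: open_delete Compl_eq_Diff_UNIV)
  have pm: "g (q x) = x \<or> g (q x) = - x" if "x \<noteq> 0" for x
    using g(3)[of "q x"] q0 q_eq that by auto
  have conts: "continuous_on ?P (\<lambda>x. g (q x))"
    by (rule continuous_on_compose2[OF g(1) cont]) (simp only: surj)
  \<comment> \<open>\<open>A 1\<close> and \<open>A (- 1)\<close> record which of x and -x the
    section selects. They split a connected space into disjoint closed sets, so one is empty;
    negation exchanges them, so both are.\<close>
  define A where "A s = {x \<in> ?P. g (q x) = s *\<^sub>R x}" for s :: real
  have closedin: "closedin (top_of_set ?P) (A s)" for s
  proof -
    have "closedin (top_of_set ?P) {x \<in> ?P. g (q x) - s *\<^sub>R x = 0}"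
      by (intro continuous_closedin_preimage_constant continuous_intros conts)
    then show ?thesis by (simp add: A_def)
  qed
  have "A 1 \<union> A (- 1) = ?P"
    using pm by (auto simp: A_def)
  moreover have "A 1 \<inter> A (- 1) = {}"
    by (auto simp: A_def eq_neg_iff_add_eq_0 simp flip: scaleR_2)
  ultimately have "A 1 = {} \<or> A (- 1) = {}"
    using \<open>connected ?P\<close>[unfolded connected_closedin_eq] closedin by blast
  moreover have "x \<in> A s \<longleftrightarrow> - x \<in> A (- s)" for x s
    by (simp add: A_def qneg)
  moreover obtain b :: 'b where "b \<in> Basis" using nonempty_Basis by blast
  ultimately have "A 1 = {} \<and> A (- 1) = {}"
    by (metis add.inverse_inverse all_not_in_conv)
  then show False
    using \<open>A 1 \<union> A (- 1) = ?P\<close> \<open>b \<in> Basis\<close> nonzero_Basis by fastforce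
qed

text \<open>Hopf's theorem lives on a Euclidean type, the subalgebras in an arbitrary real vector
  space. Sending the orthonormal basis \<open>Basis\<close> to \<open>B\<close> connects the
  two.\<close>

lemma ex_bij_linear_of_dim:
  fixes S :: "'a::real_vector set"
  assumes "finite B" "independent B" "span B = S" "card B = DIM('b::euclidean_space)"
  obtains h :: "'b::euclidean_space \<Rightarrow> 'a" where "linear h" "inj h" "range h = S"
proof -
  have "\<exists>k. bij_betw k (Basis :: 'b set) B"
    by (rule finite_same_card_bij) (simp_all add: assms)
  then obtain k where k: "bij_betw k (Basis :: 'b set) B" ..
  define h where "h v = (\<Sum>b\<in>Basis. (v \<bullet> b) *\<^sub>R k b)" for v :: 'b
  have lin: "linear h"
    by (rule linearI) (simp_all add: h_def inner_add_left scaleR_add_left sum.distrib scaleR_sum_right)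
  have hk: "h b = k b" if "b \<in> Basis" for b
    using that by (simp add: h_def inner_Basis if_distrib[of "\<lambda>c. c *\<^sub>R _"] cong: if_cong)
  have img: "h ` Basis = B" using hk k by (simp add: bij_betw_def)
  have "independent (h ` Basis)" "inj_on h Basis"
    using hk k assms(2) img by (auto simp: bij_betw_def inj_on_def)
  then have "inj_on h (span Basis)"
    using linear_inj_on_span_iff_independent_image[OF lin] by blast
  moreover have "range h = S"
    using linear_span_image[OF lin, of Basis] img assms(3) by simp
  ultimately show ?thesis using lin that by simp
qed

section \<open>The identity $(x,x,x)=0$ in dimension four\<close>

locale third_power_division =
  fixes m :: "'a::real_vector \<Rightarrow> 'a \<Rightarrow> 'a" and e :: 'a
  assumes bilinear: "bilinear m"
    and unit [simp]: "m e x = x" "m x e = x"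
    and no_zero_divisors: "m x y = 0 \<Longrightarrow> x = 0 \<or> y = 0"
    and third_power: "m (m x x) x = m x (m x x)"
begin

lemmas m_simps = bilinear_ladd[OF bilinear] bilinear_radd[OF bilinear]
  bilinear_lmul[OF bilinear] bilinear_rmul[OF bilinear]
  bilinear_lsub[OF bilinear] bilinear_rsub[OF bilinear]
  bilinear_lneg[OF bilinear] bilinear_rneg[OF bilinear]
  bilinear_lzero[OF bilinear] bilinear_rzero[OF bilinear]

text \<open>In this alternating product (x,x,x) = 0 reads [x^2, x] = 0, and commutativity of a span
  need only be checked on pairs of generators.\<close>

definition commutator :: "'a \<Rightarrow> 'a \<Rightarrow> 'a" where
  "commutator x y = m x y - m y x"

lemma bilinear_commutator: "bilinear commutator"
  unfolding bilinear_def commutator_def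
  by (intro conjI allI linearI) (simp_all add: m_simps algebra_simps)

lemmas commutator_simps = bilinear_ladd[OF bilinear_commutator] bilinear_radd[OF bilinear_commutator]
  bilinear_lmul[OF bilinear_commutator] bilinear_rmul[OF bilinear_commutator]
  bilinear_lsub[OF bilinear_commutator] bilinear_rsub[OF bilinear_commutator]

lemma commutator_self [simp]: "commutator x x = 0"
  and commutator_unit [simp]: "commutator e x = 0" "commutator x e = 0"
  and commutator_square [simp]: "commutator (m x x) x = 0" "commutator x (m x x) = 0"
  by (simp_all add: commutator_def third_power)

lemma commutator_swap: "commutator x y = - commutator y x"
  by (simp add: commutator_def)

text \<open>This is the part of [u^2, u] linear in z at u = y + z. Subtracting the value at y - z
  keeps the odd part in z, and its cubic term [z^2, z] vanishes.\<close>

lemma linearized_third_power: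
  "commutator (m y y) z + commutator (m y z + m z y) y = 0"
proof -
  let ?p = "\<lambda>u. commutator (m u u) u"
  have "?p (y + z) - ?p (y - z) =
      2 *\<^sub>R (commutator (m y y) z + commutator (m y z + m z y) y) + 2 *\<^sub>R ?p z"
    by (simp only: m_simps commutator_simps) (simp add: algebra_simps scaleR_2)
  then show ?thesis by simp
qed

text \<open>
  Every \<open>z y\<close> commutes with \<open>y\<close>. If \<open>u\<close> and \<open>w\<close> did not commute, left multiplication by \<open>z\<close>
  would therefore act on \<open>S\<close> modulo \<open>e, z\<close> as a scalar \<open>D\<close>, and \<open>z - D e\<close> would be a zero divisor.
\<close>

lemma central_no_noncommuting:
  assumes closed: "\<And>y z. y \<in> S \<Longrightarrow> z \<in> S \<Longrightarrow> m y z \<in> S"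
    and S: "subspace S" "z \<in> S" "u \<in> S" "w \<in> S"
    and rep: "\<And>y. y \<in> S \<Longrightarrow> \<exists>A B C D. y = A *\<^sub>R e + B *\<^sub>R z + C *\<^sub>R u + D *\<^sub>R w"
    and indep: "\<And>A B C D. A *\<^sub>R e + B *\<^sub>R z + C *\<^sub>R u + D *\<^sub>R w = 0 \<Longrightarrow>
      A = 0 \<and> B = 0 \<and> C = 0 \<and> D = 0"
    and central: "\<And>y. y \<in> S \<Longrightarrow> commutator z y = 0"
  shows "commutator u w = 0"
proof (rule ccontr)
  assume c: "commutator u w \<noteq> 0"
  \<comment> \<open>Since z commutes with y and with y^2, the linearized identity reduces to 2
    [zy, y] = 0.\<close>
  have zy: "commutator (m z y) y = 0" if "y \<in> S" for y
  proof -
    have "m y z = m z y" using central[OF that] by (simp add: commutator_def)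
    moreover have "commutator (m y y) z = 0"
      using central[OF closed[OF that that]] commutator_swap[of z] by simp
    ultimately have "commutator (m z y + m z y) y = 0"
      using linearized_third_power[of y z] by simp
    then show ?thesis by (simp add: commutator_simps flip: scaleR_2)
  qed
  have zu0: "commutator z u = 0" and zw0: "commutator z w = 0"
    using central S by auto
  obtain A B C D where zw: "m z w = A *\<^sub>R e + B *\<^sub>R z + C *\<^sub>R u + D *\<^sub>R w"
    using rep closed S by meson
  obtain A' B' C' D' where zu: "m z u = A' *\<^sub>R e + B' *\<^sub>R z + C' *\<^sub>R u + D' *\<^sub>R w"
    using rep closed S by meson
  \<comment> \<open>Applying \<open>zy\<close> to w, u and u + w gives in turn \<open>C = 0\<close>,
    \<open>D' = 0\<close> and \<open>D = C'\<close>, so modulo e and z both u and w are multiplied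
    by the same scalar \<open>D\<close>.\<close>
  have "C *\<^sub>R commutator u w = 0"
    using zy[OF S(4)] by (simp add: zw commutator_simps zw0)
  then have C: "C = 0" using c by simp
  have "D' *\<^sub>R commutator w u = 0"
    using zy[OF S(3)] by (simp add: zu commutator_simps zu0)
  then have D': "D' = 0" using c commutator_swap[of u w] by auto
  have "commutator (m z (u + w)) (u + w) = (C' - D) *\<^sub>R commutator u w"
    using zu0 zw0 commutator_swap[of w u]
    by (simp add: m_simps zu zw C D' commutator_simps algebra_simps)
  then have D: "D = C'" using zy[of "u + w"] S c by (simp add: subspace_add)
  \<comment> \<open>Now z - De maps u to B'(z - De) + (A' + DB')e, and similarly w. The nontrivial
    pair \<open>P\<close>, \<open>Q\<close> cancels the multiples of e, and \<open>R\<close> e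
    cancels the remaining multiple of z - De.\<close>
  define P where "P = (if A + D * B = 0 \<and> A' + D * B' = 0 then 1 else A + D * B)"
  define Q where "Q = (if A + D * B = 0 \<and> A' + D * B' = 0 then 0 else - (A' + D * B'))"
  have PQ: "P * (A' + D * B') + Q * (A + D * B) = 0"
    by (auto simp: P_def Q_def algebra_simps)
  have "P \<noteq> 0 \<or> Q \<noteq> 0" by (auto simp: P_def Q_def)
  define R where "R = - (P * B' + Q * B)"
  have "m (z - D *\<^sub>R e) (P *\<^sub>R u + Q *\<^sub>R w + R *\<^sub>R e) =
      (P * A' + Q * A - R * D) *\<^sub>R e + (P * B' + Q * B + R) *\<^sub>R z"
    by (simp add: m_simps zu zw C D' D algebra_simps)
  also have "P * A' + Q * A - R * D = 0"
    using PQ by (simp add: R_def algebra_simps)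
  finally have "m (z - D *\<^sub>R e) (P *\<^sub>R u + Q *\<^sub>R w + R *\<^sub>R e) = 0"
    by (simp add: R_def)
  then have "z - D *\<^sub>R e = 0 \<or> P *\<^sub>R u + Q *\<^sub>R w + R *\<^sub>R e = 0"
    by (rule no_zero_divisors)
  then show False
    using indep[of "- D" 1 0 0] indep[of R 0 P Q] \<open>P \<noteq> 0 \<or> Q \<noteq> 0\<close>
    by (auto simp: algebra_simps)
qed

text \<open>Among the basis vectors e, x, x^2, w only [x, w] and [x^2, w] can be nonzero. If [x, w]
  is nonzero, [x^2, w] is a multiple k [x, w], so x^2 - kx is central and
  \<open>central_no_noncommuting\<close> gives a contradiction. Then x is central, and the same
  lemma kills [x^2, w].\<close>

lemma four_dimensional_commutative:
  assumes closed: "\<And>y z. y \<in> S \<Longrightarrow> z \<in> S \<Longrightarrow> m y z \<in> S"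
    and S: "subspace S" "x \<in> S" "w \<in> S"
    and rep: "\<And>y. y \<in> S \<Longrightarrow> \<exists>A B C D. y = A *\<^sub>R e + B *\<^sub>R x + C *\<^sub>R m x x + D *\<^sub>R w"
    and indep: "\<And>A B C D. A *\<^sub>R e + B *\<^sub>R x + C *\<^sub>R m x x + D *\<^sub>R w = 0 \<Longrightarrow>
      A = 0 \<and> B = 0 \<and> C = 0 \<and> D = 0"
    and yz: "y \<in> S" "z \<in> S"
  shows "m y z = m z y"
proof -
  have x2: "m x x \<in> S" using closed S by blast
  \<comment> \<open>Otherwise only \<open>e\<close> and \<open>y\<close> would commute with \<open>y = w + t x\<close>, so that \<open>y\<^sup>2\<close> lies in
    their span; comparing \<open>t = 0, 1, -1\<close> then expresses \<open>x\<^sup>2\<close> by \<open>e, x, w\<close>.\<close>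
  have dep: "\<exists>k. commutator (m x x) w = k *\<^sub>R commutator x w" if a: "commutator x w \<noteq> 0"
  proof (rule ccontr)
    assume no: "\<nexists>k. commutator (m x x) w = k *\<^sub>R commutator x w"
    have "\<exists>A D. m (w + t *\<^sub>R x) (w + t *\<^sub>R x) = A *\<^sub>R e + D *\<^sub>R (w + t *\<^sub>R x)" for t
    proof -
      let ?y = "w + t *\<^sub>R x"
      have "?y \<in> S" using S by (simp add: subspace_add subspace_scale)
      then obtain A B C D where y2: "m ?y ?y = A *\<^sub>R e + B *\<^sub>R x + C *\<^sub>R m x x + D *\<^sub>R w"
        using rep closed by meson
      \<comment> \<open>The left side vanishes by third-power associativity. A nonzero
        \<open>C\<close> would make [x^2, w] a multiple of [x, w]; with \<open>C = 0\<close> it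
        remains that \<open>B = D * t\<close>.\<close>
      have "commutator (m ?y ?y) ?y = (B - D * t) *\<^sub>R commutator x w + C *\<^sub>R commutator (m x x) w"
        unfolding y2 using commutator_swap[of w x] by (simp add: commutator_simps algebra_simps)
      then have eq: "(B - D * t) *\<^sub>R commutator x w + C *\<^sub>R commutator (m x x) w = 0" by simp
      have C: "C = 0"
      proof (rule ccontr)
        assume "C \<noteq> 0"
        then have "commutator (m x x) w + ((B - D * t) / C) *\<^sub>R commutator x w = 0"
          using arg_cong[OF eq, of "\<lambda>v. (1 / C) *\<^sub>R v"] by (simp add: scaleR_add_right add.commute)
        then have "commutator (m x x) w = (- ((B - D * t) / C)) *\<^sub>R commutator x w"
          by (simp only: add_eq_0_iff2 scaleR_minus_left)
        then show False using no by blast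
      qed
      then have "B = D * t" using eq a by simp
      then show ?thesis unfolding y2 C by (intro exI[of _ A] exI[of _ D]) (simp add: algebra_simps)
    qed
    from this[of 0] this[of 1] this[of "- 1"] obtain A0 D0 A1 D1 A2 D2 where
      sq: "m w w = A0 *\<^sub>R e + D0 *\<^sub>R w" "m (w + x) (w + x) = A1 *\<^sub>R e + D1 *\<^sub>R (w + x)"
      "m (w - x) (w - x) = A2 *\<^sub>R e + D2 *\<^sub>R (w - x)" by auto
    \<comment> \<open>The parallelogram identity isolates x^2 and yields a linear relation with
      coefficient -2 at x^2.\<close>
    have "m (w + x) (w + x) + m (w - x) (w - x) = 2 *\<^sub>R m w w + 2 *\<^sub>R m x x"
      by (simp add: m_simps scaleR_2)
    then have "(A1 + A2 - 2 * A0) *\<^sub>R e + (D1 - D2) *\<^sub>R x + (- 2) *\<^sub>R m x x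
        + (D1 + D2 - 2 * D0) *\<^sub>R w = 0"
      unfolding sq by (simp add: algebra_simps)
    then show False using indep by fastforce
  qed
  have a: "commutator x w = 0"
  proof (rule ccontr)
    assume "commutator x w \<noteq> 0"
    then obtain k where k: "commutator (m x x) w = k *\<^sub>R commutator x w" using dep by blast
    \<comment> \<open>This element commutes with e, x and w, and it may replace x^2 in the
      basis.\<close>
    let ?z = "m x x - k *\<^sub>R x"
    have zw: "commutator ?z w = 0" using k by (simp add: commutator_simps)
    have "commutator x w = 0"
    proof (rule central_no_noncommuting[OF closed S(1) _ S(2,3)])
      show "?z \<in> S" using S x2 by (simp add: subspace_diff subspace_scale)
    next
      fix y assume "y \<in> S"
      then obtain A B C D where y: "y = A *\<^sub>R e + B *\<^sub>R x + C *\<^sub>R m x x + D *\<^sub>R w"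
        using rep by blast
      then have "y = A *\<^sub>R e + C *\<^sub>R ?z + (B + C * k) *\<^sub>R x + D *\<^sub>R w"
        by (simp add: algebra_simps)
      then show "\<exists>A B C D. y = A *\<^sub>R e + B *\<^sub>R ?z + C *\<^sub>R x + D *\<^sub>R w" by blast
      show "commutator ?z y = 0"
        unfolding y using k by (simp add: commutator_simps)
    next
      fix A B C D assume "A *\<^sub>R e + B *\<^sub>R ?z + C *\<^sub>R x + D *\<^sub>R w = 0"
      then have "A *\<^sub>R e + (C - B * k) *\<^sub>R x + B *\<^sub>R m x x + D *\<^sub>R w = 0"
        by (simp add: algebra_simps)
      from indep[OF this] show "A = 0 \<and> B = 0 \<and> C = 0 \<and> D = 0" by auto
    qed assumption+
    then show False using \<open>commutator x w \<noteq> 0\<close> by simp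
  qed
  have b: "commutator (m x x) w = 0"
  proof (rule central_no_noncommuting[OF closed S(1,2) x2 S(3) rep indep])
    fix y assume "y \<in> S"
    then obtain A B C D where "y = A *\<^sub>R e + B *\<^sub>R x + C *\<^sub>R m x x + D *\<^sub>R w"
      using rep by blast
    then show "commutator x y = 0" using a by (simp add: commutator_simps)
  qed assumption+
  obtain A B C D where y: "y = A *\<^sub>R e + B *\<^sub>R x + C *\<^sub>R m x x + D *\<^sub>R w"
    using rep yz by blast
  obtain A' B' C' D' where z: "z = A' *\<^sub>R e + B' *\<^sub>R x + C' *\<^sub>R m x x + D' *\<^sub>R w"
    using rep yz by blast
  have "commutator y z = 0"
    unfolding y z using a b commutator_swap[of w x] commutator_swap[of w "m x x"]
    by (simp add: commutator_simps)
  then show ?thesis by (simp add: commutator_def)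
qed

end

section \<open>Subalgebras generated by one element\<close>

lemma in_span_pair: "y \<in> span {b, a} \<longleftrightarrow> (\<exists>A B. y = A *\<^sub>R a + B *\<^sub>R b)"
  by (simp add: span_breakdown_eq span_singleton image_iff diff_eq_eq) blast

lemma in_span_triple:
  "y \<in> span {c, b, a} \<longleftrightarrow> (\<exists>A B C. y = A *\<^sub>R a + B *\<^sub>R b + C *\<^sub>R c)"
  by (simp add: span_breakdown_eq span_singleton image_iff diff_eq_eq) blast

text \<open>The product of the subalgebra is pulled back along a linear isomorphism from the
  Euclidean type \<open>'b\<close>, where Hopf's theorem applies. Closure of \<open>span B\<close>
  keeps products in the range of \<open>h\<close>, so \<open>inv h\<close> inverts it there.\<close>

lemma commutative_subalgebra_dim:
  fixes m :: "'a::real_vector \<Rightarrow> 'a \<Rightarrow> 'a"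
  assumes B: "finite B" "independent B" "card B = DIM('b::euclidean_space)"
    and m: "bilinear m" and nz: "\<And>x y. m x y = 0 \<Longrightarrow> x = 0 \<or> y = 0"
    and closed: "\<And>x y. x \<in> span B \<Longrightarrow> y \<in> span B \<Longrightarrow> m x y \<in> span B"
    and comm: "\<And>x y. x \<in> span B \<Longrightarrow> y \<in> span B \<Longrightarrow> m x y = m y x"
  shows "DIM('b) \<le> 2"
proof -
  obtain h :: "'b \<Rightarrow> 'a" where h: "linear h" "inj h" "range h = span B"
    using ex_bij_linear_of_dim[OF B(1,2) refl B(3)] .
  define f where "f u v = inv h (m (h u) (h v))" for u v
  have hin: "h u \<in> span B" for u using h(3) by blast
  have hf: "h (f u v) = m (h u) (h v)" for u v
    unfolding f_def using closed[OF hin hin] h(3) by (intro f_inv_into_f) auto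
  note lin = linear_add[OF h(1)] linear_scale[OF h(1)] linear_0[OF h(1)]
  show ?thesis
  proof (rule hopf_commutative_division)
    show "bilinear f"
      unfolding bilinear_def
      by (intro conjI allI linearI injD[OF h(2)])
        (simp_all add: lin hf bilinear_ladd[OF m] bilinear_radd[OF m] bilinear_lmul[OF m] bilinear_rmul[OF m])
    show "f u v = f v u" for u v
      by (rule injD[OF h(2)]) (simp add: hf comm[OF hin hin])
    show "u = 0 \<or> v = 0" if "f u v = 0" for u v
    proof -
      have "m (h u) (h v) = 0" using hf[of u v] that lin(3) by simp
      then have "h u = h 0 \<or> h v = h 0" using nz lin(3) by simp
      then show ?thesis using h(2) by (auto dest: injD)
    qed
  qed
qed

lemma subalgebra_generated:
  fixes m :: "'a::real_vector \<Rightarrow> 'a \<Rightarrow> 'a"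
  shows "subalgebra m (generated_subalgebra m x)"
  unfolding generated_subalgebra_def
proof (rule hull_in)
  fix T :: "'a set set" assume "Ball T (subalgebra m)"
  then show "subalgebra m (\<Inter>T)"
    unfolding subalgebra_def by (intro conjI subspace_Inter) blast+
qed

lemma generator_in_generated: "x \<in> generated_subalgebra m x"
  unfolding generated_subalgebra_def by (rule hull_inc) simp

lemma generated_subset:
  assumes "subalgebra m S" "x \<in> S"
  shows "generated_subalgebra m x \<subseteq> S"
  unfolding generated_subalgebra_def using assms by (intro hull_minimal) auto

text \<open>\<open>Max\<close> bounds its elements only on a finite set; the size of a finite
  spanning set bounds all the dimensions.\<close>

lemma dim_generated_le_alg_degree:
  fixes m :: "'a::real_vector \<Rightarrow> 'a \<Rightarrow> 'a"
  assumes "finite B" "span B = (UNIV :: 'a set)"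
  shows "dim (generated_subalgebra m x) \<le> alg_degree m"
proof -
  have "dim (generated_subalgebra m y) \<le> card B" for y
    by (rule dim_le_card) (simp_all add: assms)
  then have "{dim (generated_subalgebra m y) | y. True} \<subseteq> {..card B}" by blast
  then have "finite {dim (generated_subalgebra m y) | y. True}"
    by (rule finite_subset) simp
  then show ?thesis
    unfolding alg_degree_def by (rule Max_ge) blast
qed

text \<open>A dimension count: a vector of \<open>S\<close> missed by \<open>f\<close>, added to the
  image of a basis of \<open>S\<close>, would be an independent set in \<open>S\<close> larger than
  the basis.\<close>

lemma linear_inj_onto_subspace:
  fixes f :: "'a::real_vector \<Rightarrow> 'a"
  assumes f: "linear f" "inj f" and S: "subspace S" "f ` S \<subseteq> S"
    and W: "finite W" "S \<subseteq> span W"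
  shows "f ` S = S"
proof (rule ccontr)
  assume "f ` S \<noteq> S"
  then obtain s where s: "s \<in> S" "s \<notin> f ` S" using S(2) by blast
  obtain B where B: "B \<subseteq> S" "independent B" "span B = S"
    by (metis S(1) basis_exists span_subspace)
  have finB: "finite B" using independent_span_bound[OF W(1) B(2)] B(1) W(2) by blast
  have "independent (f ` B)" "inj_on f B"
    using linear_independent_injective_image[OF f(1) B(2)] inj_on_subset[OF f(2)] by auto
  moreover have "span (f ` B) = f ` S" using linear_span_image[OF f(1)] B(3) by simp
  ultimately have "independent (insert s (f ` B))" "s \<notin> f ` B"
    using s(2) by (metis independent_insertI, metis span_base)
  moreover have "insert s (f ` B) \<subseteq> span B" using s B S(2) by auto
  ultimately have "card (insert s (f ` B)) \<le> card B"
    using independent_span_bound[OF finB] by blast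
  then show False
    using \<open>s \<notin> f ` B\<close> finB \<open>inj_on f B\<close> by (simp add: card_image)
qed

text \<open>Left multiplication by x is injective on the finite-dimensional A(x), hence onto, so xf
  = x for some f in A(x). Cancelling x against xe = x gives f = e.\<close>

lemma unit_in_generated:
  fixes m :: "'a::real_vector \<Rightarrow> 'a \<Rightarrow> 'a"
  assumes m: "bilinear m" and u: "two_sided_unit m e"
    and nz: "\<And>x y. m x y = 0 \<Longrightarrow> x = 0 \<or> y = 0"
    and W: "finite W" "span W = (UNIV :: 'a set)" and x: "x \<noteq> 0"
  shows "e \<in> generated_subalgebra m x"
proof -
  let ?S = "generated_subalgebra m x"
  have "inj (m x)"
  proof (rule injI)
    fix y z assume "m x y = m x z"
    then have "m x (y - z) = 0" by (simp add: bilinear_rsub[OF m])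
    then show "y = z" using nz x by fastforce
  qed
  moreover have "linear (m x)" using m by (simp add: bilinear_def)
  moreover have S: "subspace ?S" "m x ` ?S \<subseteq> ?S"
    using subalgebra_generated[of m x] generator_in_generated[of x m]
    by (auto simp: subalgebra_def)
  ultimately have "m x ` ?S = ?S"
    using linear_inj_onto_subspace[of "m x" ?S W] W by simp
  then obtain f where f: "f \<in> ?S" "m x f = x" using generator_in_generated[of x m] by force
  have "m x e = x" using u by (simp add: two_sided_unit_def)
  then have "f = e" using f(2) injD[OF \<open>inj (m x)\<close>, of f e] by simp
  then show ?thesis using f by simp
qed

section \<open>Third-power associativity, quadratic relations and power-associativity\<close>

theorem third_power_associative_imp_quadratic:
  fixes m :: "'a::real_vector \<Rightarrow> 'a \<Rightarrow> 'a"
  assumes A: "real_division_algebra m" and deg: "alg_degree m \<le> 4"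
    and u: "two_sided_unit m e" and tp: "\<And>x. associator m x x x = 0"
  shows "quadratic_algebra m"
proof -
  from A have m: "bilinear m" by (simp add: real_division_algebra_def)
  have nz: "x = 0 \<or> y = 0" if "m x y = 0" for x y
  proof (rule ccontr)
    assume "\<not> (x = 0 \<or> y = 0)"
    then have "inj (m x)" "y \<noteq> 0"
      using A by (auto simp: real_division_algebra_def bij_def)
    then show False using that bilinear_rzero[OF m, of x] by (metis injD)
  qed
  interpret third_power_division m e
    using m nz u tp by unfold_locales (auto simp: two_sided_unit_def associator_def)
  obtain W :: "'a set" where W: "finite W" "span W = UNIV"
    using A by (auto simp: real_division_algebra_def)
  have "\<exists>a b c. (a, b, c) \<noteq> (0, 0, 0) \<and> a *\<^sub>R e + b *\<^sub>R x + c *\<^sub>R m x x = 0" for x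
  proof (rule ccontr)
    assume "\<not> ?thesis"
    then have ind3: "a = 0 \<and> b = 0 \<and> c = 0" if "a *\<^sub>R e + b *\<^sub>R x + c *\<^sub>R m x x = 0" for a b c
      using that by blast
    define S where "S = generated_subalgebra m x"
    have S: "subspace S" and closed: "\<And>y z. y \<in> S \<Longrightarrow> z \<in> S \<Longrightarrow> m y z \<in> S"
      and x: "x \<in> S" using subalgebra_generated[of m x] generator_in_generated[of x m]
      by (auto simp: S_def subalgebra_def)
    have "x \<noteq> 0" using ind3[of 0 1 0] by (auto simp: m_simps)
    then have e: "e \<in> S" unfolding S_def using unit_in_generated[OF m u nz W] by blast
    define T where "T = {m x x, x, e}"
    have T: "T \<subseteq> S" using x e closed by (auto simp: T_def)
    have spanT: "y \<in> span T \<longleftrightarrow> (\<exists>A B C. y = A *\<^sub>R e + B *\<^sub>R x + C *\<^sub>R m x x)" for y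
      unfolding T_def by (rule in_span_triple)
    \<comment> \<open>\<open>ind3\<close> is independence of a family. It also makes the three
      vectors distinct, so that the set \<open>T\<close> really has three elements.\<close>
    have "e \<noteq> 0" using ind3[of 1 0 0] by auto
    moreover have xe: "x \<noteq> a *\<^sub>R e" for a
      using ind3[of a "- 1" 0] by auto
    moreover have x2: "m x x \<noteq> a *\<^sub>R e + b *\<^sub>R x" for a b
      using ind3[of a b "- 1"] by auto
    moreover have "x \<noteq> e" "m x x \<noteq> e" "m x x \<noteq> x"
      using xe[of 1] x2[of 1 0] x2[of 0 1] by auto
    ultimately have indT: "independent T" and cardT: "card T = 3" "finite T"
      unfolding T_def
      by (auto simp: independent_insert in_span_pair span_singleton)
    show False
    proof (cases "S \<subseteq> span T")
      case True
      then have "span T = S" using T S by (simp add: span_minimal subset_antisym)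
      \<comment> \<open>Among e, x and x^2 only x and x^2 could fail to commute, and
        \<open>third_power\<close> says that they do commute.\<close>
      have "m y z = m z y" if "y \<in> span T" "z \<in> span T" for y z
        using that third_power by (auto simp: spanT m_simps algebra_simps)
      then have "DIM(real ^ 3) \<le> 2"
        using commutative_subalgebra_dim[where 'b = "real ^ 3", OF cardT(2) indT _ m nz]
          cardT closed \<open>span T = S\<close> by simp
      then show False by simp
    next
      case False
      then obtain w where w: "w \<in> S" "w \<notin> span T" by blast
      let ?T = "insert w T"
      have ind4: "A = 0 \<and> B = 0 \<and> C = 0 \<and> D = 0"
        if 0: "A *\<^sub>R e + B *\<^sub>R x + C *\<^sub>R m x x + D *\<^sub>R w = 0" for A B C D
      proof (cases "D = 0")
        case False
        have "A *\<^sub>R e + B *\<^sub>R x + C *\<^sub>R m x x \<in> span T" using spanT by blast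
        moreover have "D *\<^sub>R w = - (A *\<^sub>R e + B *\<^sub>R x + C *\<^sub>R m x x)"
          using 0 by (simp add: add_eq_0_iff)
        ultimately have "D *\<^sub>R w \<in> span T" by (simp only: span_neg)
        then have "(1 / D) *\<^sub>R D *\<^sub>R w \<in> span T" by (rule span_scale)
        then show ?thesis using w(2) False by simp
      qed (use ind3 0 in auto)
      have indep: "independent ?T" using indT w(2) by (simp add: independent_insertI)
      have card: "card ?T = 4" "finite ?T"
        using cardT w(2) span_base by (auto simp: card_insert_if)
      have sub: "?T \<subseteq> S" using T w(1) by simp
      \<comment> \<open>The degree bound enters here: a further vector \<open>v\<close> would give
        five independent elements of A(x).\<close>
      have "S \<subseteq> span ?T"
      proof (rule ccontr)
        assume "\<not> S \<subseteq> span ?T"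
        then obtain v where v: "v \<in> S" "v \<notin> span ?T" by blast
        then have ind: "independent (insert v ?T)" and vT: "v \<notin> ?T"
          using indep by (metis independent_insertI, metis span_base)
        obtain B where B: "B \<subseteq> S" "independent B" "S \<subseteq> span B" "card B = dim S"
          by (rule basis_exists)
        have "finite B" using independent_span_bound[OF W(1) B(2)] W(2) by simp
        moreover have "insert v ?T \<subseteq> span B" using v(1) sub B(3) by blast
        ultimately have "card (insert v ?T) \<le> card B"
          using independent_span_bound[OF _ ind] by simp
        also have "card B \<le> 4"
          unfolding B(4) S_def using dim_generated_le_alg_degree[OF W, of m x] deg by simp
        finally show False
          using card(1) card_insert_disjoint[OF card(2) vT] by linarith
      qed
      then have span: "span ?T = S" using sub S by (simp add: span_minimal subset_antisym)
      have rep: "\<exists>A B C D. y = A *\<^sub>R e + B *\<^sub>R x + C *\<^sub>R m x x + D *\<^sub>R w" if "y \<in> S" for y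
        using that unfolding span[symmetric] span_breakdown_eq[of _ w] spanT diff_eq_eq by blast
      have "m y z = m z y" if "y \<in> S" "z \<in> S" for y z
        using four_dimensional_commutative[OF closed S x w(1) rep ind4 that] .
      then have "DIM(real ^ 4) \<le> 2"
        using commutative_subalgebra_dim[where 'b = "real ^ 4", OF card(2) indep _ m nz]
          card closed span by simp
      then show False by simp
    qed
  qed
  then show ?thesis using u unfolding quadratic_algebra_def by blast
qed

text \<open>Once x^2 is a combination of e and x, the span of e and x is a subalgebra containing
  A(x). Products in it are those of polynomials in x reduced by one quadratic relation, hence
  associative.\<close>

lemma quadratic_imp_power_associative:
  assumes m: "bilinear m" and Q: "quadratic_algebra m"
  shows "power_associative m"
proof -
  from Q obtain e where u: "two_sided_unit m e"
    and dep: "\<And>x. \<exists>a b c. (a, b, c) \<noteq> (0, 0, 0) \<and> a *\<^sub>R e + b *\<^sub>R x + c *\<^sub>R m x x = 0"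
    unfolding quadratic_algebra_def by blast
  note m_simps = bilinear_ladd[OF m] bilinear_radd[OF m] bilinear_lmul[OF m] bilinear_rmul[OF m]
  have ue [simp]: "m e y = y" "m y e = y" for y using u by (auto simp: two_sided_unit_def)
  have sq: "\<exists>\<alpha> \<beta>. m x x = \<alpha> *\<^sub>R e + \<beta> *\<^sub>R x" for x
  \<comment> \<open>For a multiple of e the given relation may have coefficient 0 at x^2, so x^2 =
    cx is computed directly. Otherwise e and x are independent, and the relation can be solved for
    x^2.\<close>
  proof (cases "\<exists>c. x = c *\<^sub>R e")
    case True
    then obtain c where c: "x = c *\<^sub>R e" ..
    have "m x x = 0 *\<^sub>R e + c *\<^sub>R x" unfolding c by (simp add: m_simps)
    then show ?thesis by blast
  next
    case False
    obtain a b c where abc: "(a, b, c) \<noteq> (0, 0, 0)" "a *\<^sub>R e + b *\<^sub>R x + c *\<^sub>R m x x = 0"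
      using dep by blast
    have solve: "v = (- 1 / k) *\<^sub>R u" if "k \<noteq> 0" "u + k *\<^sub>R v = 0" for k :: real and u v :: 'a
    proof -
      have "(1 / k) *\<^sub>R (u + k *\<^sub>R v) = 0" using that(2) by simp
      then have "(1 / k) *\<^sub>R u + v = 0" using that(1) by (simp add: scaleR_add_right)
      then show ?thesis by (simp add: add_eq_0_iff)
    qed
    have "c \<noteq> 0"
    proof
      assume "c = 0"
      moreover have "e \<noteq> 0"
        using False ue(1)[of x] by (metis m_simps(3) scaleR_zero_left)
      ultimately have "b \<noteq> 0" using abc by auto
      then have "x = (- 1 / b) *\<^sub>R a *\<^sub>R e" using solve[of b "a *\<^sub>R e" x] abc(2) \<open>c = 0\<close> by simp
      then show False using False by (metis scaleR_scaleR)
    qed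
    then have "m x x = (- 1 / c) *\<^sub>R (a *\<^sub>R e + b *\<^sub>R x)" using solve abc(2) by blast
    then show ?thesis by (metis scaleR_add_right scaleR_scaleR)
  qed
  show ?thesis
    unfolding power_associative_def
  proof (intro allI ballI)
    fix x a b c
    assume abc: "a \<in> generated_subalgebra m x" "b \<in> generated_subalgebra m x"
      "c \<in> generated_subalgebra m x"
    obtain \<alpha> \<beta> where x2: "m x x = \<alpha> *\<^sub>R e + \<beta> *\<^sub>R x" using sq by blast
    have span: "y \<in> span {x, e} \<longleftrightarrow> (\<exists>A B. y = A *\<^sub>R e + B *\<^sub>R x)" for y
      by (rule in_span_pair)
    have "m y z \<in> span {x, e}" if yz: "y \<in> span {x, e}" "z \<in> span {x, e}" for y z
    proof -
      obtain A B A' B' where "y = A *\<^sub>R e + B *\<^sub>R x" "z = A' *\<^sub>R e + B' *\<^sub>R x"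
        using yz span by meson
      then have "m y z = (A * A' + B * B' * \<alpha>) *\<^sub>R e + (A * B' + B * A' + B * B' * \<beta>) *\<^sub>R x"
        by (simp add: m_simps x2 algebra_simps)
      then show ?thesis unfolding span by blast
    qed
    then have "subalgebra m (span {x, e})" by (simp add: subalgebra_def)
    then have "generated_subalgebra m x \<subseteq> span {x, e}"
      by (rule generated_subset) (simp add: span_base)
    then obtain A B A' B' A'' B'' where "a = A *\<^sub>R e + B *\<^sub>R x" "b = A' *\<^sub>R e + B' *\<^sub>R x"
      "c = A'' *\<^sub>R e + B'' *\<^sub>R x"
      using abc span by (meson subsetD)
    then show "m (m a b) c = m a (m b c)"
      by (simp add: m_simps x2 algebra_simps)
  qed
qed

section \<open>Reduction of the associator identities\<close>

text \<open>Evaluation at 0, 1, -1 and 2 determines the coefficients: 1 and -1 give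
  \<open>c = 0\<close> and \<open>b = - d\<close>, after which 2 leaves 6d = 0.\<close>

lemma vector_cubic_eq_0:
  fixes a b c d :: "'a::real_vector"
  assumes "\<And>t. a + t *\<^sub>R b + t\<^sup>2 *\<^sub>R c + t ^ 3 *\<^sub>R d = 0"
  shows "b = 0" "c = 0" "d = 0"
proof -
  have a: "a = 0" using assms[of 0] by simp
  have 1: "b + c + d = 0" and 2: "- b + c - d = 0" and 3: "2 *\<^sub>R b + 4 *\<^sub>R c + 8 *\<^sub>R d = 0"
    using assms[of 1] assms[of "- 1"] assms[of 2] a by simp_all
  have "2 *\<^sub>R c = (b + c + d) + (- b + c - d)" by (simp add: scaleR_2)
  then show c: "c = 0" using 1 2 by simp
  then have b: "b = - d" using 1 by (simp add: add_eq_0_iff2)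
  have "(8 - 2) *\<^sub>R d = 0"
    using 3 unfolding b c scaleR_left_diff_distrib by simp
  then show d: "d = 0" by simp
  show "b = 0" using b d by simp
qed

text \<open>Associators with an entry e vanish, so under x -> x + te an entry x is unchanged and an
  entry x^2 becomes x^2 + 2tx. If k of the exponents are 2, the coefficient of t^k is 2^k
  (x,x,x).\<close>

lemma third_power_of_associator_identity:
  fixes m :: "'a::real_vector \<Rightarrow> 'a \<Rightarrow> 'a"
  assumes m: "bilinear m" and u: "two_sided_unit m e"
    and pqr: "p \<in> {1, 2}" "q \<in> {1, 2}" "r \<in> {1, 2}"
    and id: "\<And>x. associator m (alg_pow m x p) (alg_pow m x q) (alg_pow m x r) = 0"
  shows "associator m x x x = 0"
proof -
  note m_simps = bilinear_ladd[OF m] bilinear_radd[OF m] bilinear_lmul[OF m] bilinear_rmul[OF m]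
  have e [simp]: "m e y = y" "m y e = y" for y using u by (auto simp: two_sided_unit_def)
  let ?T = "associator m" and ?s = "m x x"
  have pow: "alg_pow m y 1 = y" "alg_pow m y 2 = m y y" for y
    by (simp_all add: alg_pow_def numeral_2_eq_2)
  have T_simps: "?T (y + y') z w = ?T y z w + ?T y' z w" "?T y (z + z') w = ?T y z w + ?T y z' w"
    "?T y z (w + w') = ?T y z w + ?T y z w'" "?T (c *\<^sub>R y) z w = c *\<^sub>R ?T y z w"
    "?T y (c *\<^sub>R z) w = c *\<^sub>R ?T y z w" "?T y z (c *\<^sub>R w) = c *\<^sub>R ?T y z w"
    "?T e z w = 0" "?T y e w = 0" "?T y z e = 0" for y y' z z' w w' c
    by (simp_all add: associator_def m_simps algebra_simps)
  have sq: "m (x + t *\<^sub>R e) (x + t *\<^sub>R e) = ?s + (2 * t) *\<^sub>R x + (t * t) *\<^sub>R e" for t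
    by (simp add: m_simps algebra_simps flip: scaleR_2)
  note ids = id[of "x + _ *\<^sub>R e"]
  note expand = T_simps algebra_simps power2_eq_square power3_eq_cube
  \<comment> \<open>The cases are ordered by the number of squares, which is the power of t whose
    coefficient is read off.\<close>
  consider "p = 1" "q = 1" "r = 1"
    | "p = 2" "q = 1" "r = 1" | "p = 1" "q = 2" "r = 1" | "p = 1" "q = 1" "r = 2"
    | "p = 1" "q = 2" "r = 2" | "p = 2" "q = 1" "r = 2" | "p = 2" "q = 2" "r = 1"
    | "p = 2" "q = 2" "r = 2"
    using pqr by auto
  then show ?thesis
  proof cases
    case 1
    show ?thesis using id[of x] unfolding 1 pow .
  next
    case 2
    \<comment> \<open>The zero coefficients pad the polynomial to a cubic, so that
      \<open>vector_cubic_eq_0\<close> serves all cases.\<close>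
    have "?T ?s x x + t *\<^sub>R (2 *\<^sub>R ?T x x x) + t\<^sup>2 *\<^sub>R 0 + t ^ 3 *\<^sub>R 0 = 0" for t
      using ids[of t] unfolding 2 pow sq by (simp add: expand)
    from vector_cubic_eq_0(1)[OF this] show ?thesis by simp
  next
    case 3
    have "?T x ?s x + t *\<^sub>R (2 *\<^sub>R ?T x x x) + t\<^sup>2 *\<^sub>R 0 + t ^ 3 *\<^sub>R 0 = 0" for t
      using ids[of t] unfolding 3 pow sq by (simp add: expand)
    from vector_cubic_eq_0(1)[OF this] show ?thesis by simp
  next
    case 4
    have "?T x x ?s + t *\<^sub>R (2 *\<^sub>R ?T x x x) + t\<^sup>2 *\<^sub>R 0 + t ^ 3 *\<^sub>R 0 = 0" for t
      using ids[of t] unfolding 4 pow sq by (simp add: expand)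
    from vector_cubic_eq_0(1)[OF this] show ?thesis by simp
  next
    case 5
    have "?T x ?s ?s + t *\<^sub>R (2 *\<^sub>R ?T x x ?s + 2 *\<^sub>R ?T x ?s x) + t\<^sup>2 *\<^sub>R (4 *\<^sub>R ?T x x x) + t ^ 3 *\<^sub>R 0 = 0" for t
      using ids[of t] unfolding 5 pow sq by (simp add: expand)
    from vector_cubic_eq_0(2)[OF this] show ?thesis by simp
  next
    case 6
    have "?T ?s x ?s + t *\<^sub>R (2 *\<^sub>R ?T x x ?s + 2 *\<^sub>R ?T ?s x x) + t\<^sup>2 *\<^sub>R (4 *\<^sub>R ?T x x x) + t ^ 3 *\<^sub>R 0 = 0" for t
      using ids[of t] unfolding 6 pow sq by (simp add: expand)
    from vector_cubic_eq_0(2)[OF this] show ?thesis by simp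
  next
    case 7
    have "?T ?s ?s x + t *\<^sub>R (2 *\<^sub>R ?T x ?s x + 2 *\<^sub>R ?T ?s x x) + t\<^sup>2 *\<^sub>R (4 *\<^sub>R ?T x x x) + t ^ 3 *\<^sub>R 0 = 0" for t
      using ids[of t] unfolding 7 pow sq by (simp add: expand)
    from vector_cubic_eq_0(2)[OF this] show ?thesis by simp
  next
    case 8
    have "?T ?s ?s ?s + t *\<^sub>R (2 *\<^sub>R ?T x ?s ?s + 2 *\<^sub>R ?T ?s x ?s + 2 *\<^sub>R ?T ?s ?s x)
        + t\<^sup>2 *\<^sub>R (4 *\<^sub>R ?T x x ?s + 4 *\<^sub>R ?T x ?s x + 4 *\<^sub>R ?T ?s x x)
        + t ^ 3 *\<^sub>R (8 *\<^sub>R ?T x x x) = 0" for t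
      using ids[of t] unfolding 8 pow sq by (simp add: expand)
    from vector_cubic_eq_0(3)[OF this] show ?thesis by simp
  qed
qed

lemma power_associative_associator:
  assumes "power_associative m" "p \<in> {1, 2}" "q \<in> {1, 2}" "r \<in> {1, 2}"
  shows "associator m (alg_pow m x p) (alg_pow m x q) (alg_pow m x r) = 0"
proof -
  have pow: "alg_pow m x k \<in> generated_subalgebra m x" if "k \<in> {1, 2}" for k
    using that subalgebra_generated[of m x] generator_in_generated[of x m]
    by (auto simp: alg_pow_def numeral_2_eq_2 subalgebra_def)
  have "m (m a b) c = m a (m b c)"
    if "a \<in> generated_subalgebra m x" "b \<in> generated_subalgebra m x" "c \<in> generated_subalgebra m x"
    for a b c
    using assms(1) that unfolding power_associative_def by simp
  from this[OF pow[OF assms(2)] pow[OF assms(3)] pow[OF assms(4)]] show ?thesis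
    unfolding associator_def by (simp only: diff_self)
qed

theorem theorem2:
  fixes m :: "'a::real_vector \<Rightarrow> 'a \<Rightarrow> 'a" and e :: 'a and p q r :: nat
  assumes "real_division_algebra m"
    and "alg_degree m \<le> 4"
    and "two_sided_unit m e"
    and "p \<in> {1, 2}" and "q \<in> {1, 2}" and "r \<in> {1, 2}"
  shows "((\<forall>x. associator m (alg_pow m x p) (alg_pow m x q) (alg_pow m x r) = 0)
            \<longleftrightarrow> power_associative m)
       \<and> (power_associative m \<longleftrightarrow> quadratic_algebra m)"
proof -
  let ?I = "\<forall>x. associator m (alg_pow m x p) (alg_pow m x q) (alg_pow m x r) = 0"
  have m: "bilinear m" using assms(1) by (simp add: real_division_algebra_def)
  have "quadratic_algebra m" if ?I
    using third_power_associative_imp_quadratic[OF assms(1-3)]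
      third_power_of_associator_identity[OF m assms(3-6)] that by blast
  moreover have "power_associative m" if "quadratic_algebra m"
    using quadratic_imp_power_associative[OF m that] .
  moreover have ?I if "power_associative m"
    using power_associative_associator[OF that assms(4-6)] by blast
  ultimately show ?thesis by blast
qed

end
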